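(* Let $p$ be an odd prime and $r>0$ an integer. Then $$P_{p^r}(t)\equiv (1-t^{p-1})^{p^{r-1}}\pmod{p^r}.$$
   Context: For an integer $n\ge 1$, $P_n(t)=\prod_{k=0}^{n-1}(1+kt)\in\mathbb{Z}[t]$. For polynomials $A(t),B(t)\in\mathbb{Z}[t]$, $A(t)\equiv B(t)\pmod N$ means that all coefficients of $A(t)-B(t)$ are divisible by $N$. *)

theory Defs
  imports "HOL-Computational_Algebra.Polynomial" "HOL-Computational_Algebra.Primes"
begin

definition P :: "nat \<Rightarrow> int poly" where
  "P n = (\<Prod>k<n. [:1, int k:])"

text \<open>The relation \<open>[a = b] (mod N)\<close> of the library is not available on \<open>int poly\<close>,
  so congruence modulo an integer is defined coefficientwise.\<close>

definition poly_cong :: "int poly \<Rightarrow> int poly \<Rightarrow> int \<Rightarrow> bool" where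
  "poly_cong A B N \<longleftrightarrow> (\<forall>i. N dvd coeff (A - B) i)"

end

theory Submission
  imports "HOL-Number_Theory.Residues" Defs
begin

text \<open>
  Congruence modulo \<open>N\<close> is treated as divisibility of a difference by the constant polynomial
  \<open>[:N:]\<close>, and the statement is proved by induction on \<open>r\<close>.

  For \<open>r = 1\<close>, the difference of the two sides has degree at most \<open>p - 1\<close>. It vanishes modulo \<open>p\<close>
  at \<open>0\<close>, and also at every \<open>x \<in> {1..p-1}\<close>: some factor \<open>1 + k x\<close> with \<open>k < p\<close> is divisible by
  \<open>p\<close>, and so is \<open>1 - x ^ (p - 1)\<close> by Fermat. A polynomial with more roots modulo \<open>p\<close> than its degree has all its
  coefficients divisible by \<open>p\<close>.

  For the step from \<open>q = p ^ r\<close> to \<open>p q\<close>, every \<open>k < p q\<close> is written as \<open>a + q b\<close> with \<open>a < q\<close> and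
  \<open>b < p\<close>. For fixed \<open>a\<close>, expanding \<open>\<Prod>b<p. (1 + a t + q b t)\<close> in powers of \<open>q\<close> leaves only
  \<open>(1 + a t) ^ p\<close> modulo \<open>p q\<close>: the linear term contains \<open>q (\<Sum>b<p. b)\<close>, in which the sum
  \<open>p (p - 1) / 2\<close> is a multiple of \<open>p\<close> because \<open>p\<close> is odd, and the rest is divisible by
  \<open>q\<^sup>2\<close>, a multiple of \<open>p q\<close>. Hence \<open>P (p q) \<equiv> P q ^ p\<close> modulo \<open>p q\<close>. Since raising to the power \<open>p\<close> turns a
  congruence modulo \<open>q\<close> into one modulo \<open>p q\<close>, the induction hypothesis gives the claim.
\<close>

section \<open>Congruences of products and powers\<close>

lemma dvd_diff_prod:
  fixes f g :: "'b \<Rightarrow> 'a::comm_ring_1"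
  assumes "\<And>x. x \<in> A \<Longrightarrow> m dvd f x - g x"
  shows "m dvd prod f A - prod g A"
  using assms
proof (induction A rule: infinite_finite_induct)
  case (insert x A)
  have "prod f (insert x A) - prod g (insert x A)
      = (f x - g x) * prod f A + g x * (prod f A - prod g A)"
    using insert.hyps by (simp add: algebra_simps)
  then show ?case
    using insert by simp
qed simp_all

text \<open>
  In the factorisation of \<open>a ^ n - b ^ n\<close>, the cofactor of \<open>a - b\<close> is a sum of \<open>n\<close> terms each
  congruent to \<open>b ^ (n - 1)\<close> modulo \<open>q\<close>. As \<open>n\<close> divides \<open>q\<close>, the cofactor is a multiple of \<open>n\<close>.
\<close>
lemma dvd_diff_power_lift:
  fixes a b q :: "'a::comm_ring_1"
  assumes "q dvd a - b" and "of_nat n dvd q"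
  shows "of_nat n * q dvd a ^ n - b ^ n"
proof -
  have "of_nat n dvd b ^ (n - Suc i) * a ^ i - b ^ (n - 1)" if "i < n" for i
  proof -
    have "a - b dvd a ^ i - b ^ i"
      by (simp add: power_diff_sumr2)
    moreover have "b ^ (n - 1) = b ^ (n - Suc i) * b ^ i"
      using that by (simp flip: power_add)
    ultimately have "a - b dvd b ^ (n - Suc i) * a ^ i - b ^ (n - 1)"
      by (metis dvd_mult right_diff_distrib)
    then show ?thesis
      using assms dvd_trans by blast
  qed
  then have "of_nat n dvd (\<Sum>i<n. b ^ (n - Suc i) * a ^ i - b ^ (n - 1))"
    by (intro dvd_sum) auto
  then have "of_nat n dvd (\<Sum>i<n. b ^ (n - Suc i) * a ^ i) - of_nat n * b ^ (n - 1)"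
    by (simp add: sum_subtractf)
  then have "of_nat n dvd (\<Sum>i<n. b ^ (n - Suc i) * a ^ i)"
    by (metis dvd_triv_left diff_add_cancel dvd_add)
  then have "of_nat n * q dvd (\<Sum>i<n. b ^ (n - Suc i) * a ^ i) * (a - b)"
    using assms(1) by (rule mult_dvd_mono)
  then show ?thesis
    by (simp add: power_diff_sumr2 mult.commute)
qed

text \<open>
  This is the expansion in \<open>v\<close> to first order. For \<open>n = 0\<close> the truncated exponent \<open>n - 1\<close> is
  harmless, because the sum next to it is empty.
\<close>
lemma prod_arith_progression_linear:
  fixes u v :: "'a::comm_ring_1"
  assumes "m dvd v * v"
  shows "m dvd (\<Prod>b<n. u + v * of_nat b) - (u ^ n + v * u ^ (n - 1) * of_nat (\<Sum>b<n. b))"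
proof (induction n)
  case (Suc n)
  show ?case
  proof (cases n)
    case (Suc j)
    let ?s = "of_nat (\<Sum>b<n. b) :: 'a"
    have "(\<Prod>b<Suc n. u + v * of_nat b)
        - (u ^ Suc n + v * u ^ (Suc n - 1) * of_nat (\<Sum>b<Suc n. b))
      = ((\<Prod>b<n. u + v * of_nat b) - (u ^ n + v * u ^ (n - 1) * ?s)) * (u + v * of_nat n)
        + v * v * (u ^ (n - 1) * ?s * of_nat n)"
      unfolding prod.lessThan_Suc sum.lessThan_Suc of_nat_add Suc
      by (simp add: algebra_simps)
    then show ?thesis
      using Suc.IH assms by (metis dvd_add dvd_mult2)
  qed simp
qed simp

text \<open>
  The factors are grouped by residue modulo \<open>q\<close>, not into blocks of consecutive indices, because the
  factors of \<open>P (n * q)\<close> in one residue class all agree modulo \<open>q\<close>.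
\<close>
lemma prod_lessThan_mult_residues:
  fixes f :: "nat \<Rightarrow> 'a::comm_monoid_mult"
  shows "(\<Prod>k<n * q. f k) = (\<Prod>a<q. \<Prod>b<n. f (a + q * b))"
proof -
  have "(\<Prod>k<n * q. f k) = (\<Prod>b<n. \<Prod>k\<in>{b * q..<b * q + q}. f k)"
    by (simp add: prod.nat_group)
  also have "\<dots> = (\<Prod>b<n. \<Prod>a<q. f (a + q * b))"
  proof (rule prod.cong[OF refl])
    fix b
    show "(\<Prod>k\<in>{b * q..<b * q + q}. f k) = (\<Prod>a<q. f (a + q * b))"
      using prod.shift_bounds_nat_ivl[of f 0 "b * q" q]
      by (simp add: atLeast0LessThan ac_simps)
  qed
  also have "\<dots> = (\<Prod>a<q. \<Prod>b<n. f (a + q * b))"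
    by (rule prod.swap)
  finally show ?thesis .
qed

section \<open>The passage from \<open>q\<close> to \<open>p q\<close>\<close>

lemma odd_dvd_sum_lessThan:
  fixes n :: nat
  assumes "odd n"
  shows "n dvd (\<Sum>b<n. b)"
proof -
  obtain m where n: "n = Suc (2 * m)"
    using assms by (auto elim: oddE)
  have "(\<Sum>b<Suc k. b) * 2 = k * Suc k" for k :: nat
    by (induction k) auto
  from this[of "2 * m"] have "(\<Sum>b<n. b) = m * n"
    by (simp add: n)
  then show ?thesis
    by simp
qed

lemma P_mult_cong_power:
  assumes "odd p" and "p dvd q"
  shows "[:int (p * q):] dvd P (p * q) - P q ^ p"
proof -
  have "[:int (p * q):] dvd (\<Prod>b<p. [:1, int (a + q * b):]) - [:1, int a:] ^ p" for a
  proof -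
    let ?u = "[:1, int a:]" and ?v = "[:0, int q:]"
    let ?s = "of_nat (\<Sum>b<p. b) :: int poly"
    have "[:int (p * q):] dvd ?v * ?v"
      using assms(2) by (auto simp: const_poly_dvd_iff coeff_pCons split: nat.split elim!: dvdE)
    then have expansion:
      "[:int (p * q):] dvd (\<Prod>b<p. ?u + ?v * of_nat b) - (?u ^ p + ?v * ?u ^ (p - 1) * ?s)"
      by (rule prod_arith_progression_linear)
    have factor: "?u + ?v * of_nat b = [:1, int (a + q * b):]" for b
      by (simp add: of_nat_poly)
    have linear_term: "[:int (p * q):] dvd ?v * ?u ^ (p - 1) * ?s"
    proof -
      have "of_nat p dvd ?s"
        using odd_dvd_sum_lessThan[OF assms(1)] by (metis dvdE dvd_triv_left of_nat_mult)
      moreover have "[:int q:] dvd ?v * ?u ^ (p - 1)"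
        by (intro dvd_mult2) (auto simp: const_poly_dvd_iff coeff_pCons split: nat.split)
      ultimately have "[:int q:] * of_nat p dvd ?v * ?u ^ (p - 1) * ?s"
        by (intro mult_dvd_mono)
      then show ?thesis
        by (simp add: of_nat_poly mult.commute)
    qed
    have "A - B = A - (B + C) + C" for A B C :: "int poly"
      by simp
    then show ?thesis
      using dvd_add[OF expansion linear_term] unfolding factor by presburger
  qed
  then have "[:int (p * q):] dvd (\<Prod>a<q. \<Prod>b<p. [:1, int (a + q * b):]) - (\<Prod>a<q. [:1, int a:] ^ p)"
    by (rule dvd_diff_prod)
  then show ?thesis
    by (simp only: P_def prod_lessThan_mult_residues prod_power_distrib)
qed

section \<open>The case of a prime\<close>

text \<open>
  Induction on the degree: splitting off one root \<open>x\<close> as a linear factor leaves a quotient with the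
  remaining roots, because for another root \<open>y\<close> the prime \<open>p\<close> does not divide \<open>y - x\<close>.
\<close>
lemma const_prime_dvd_poly_if_many_roots:
  fixes f :: "int poly" and p :: int
  assumes "prime p" and "finite S" and "degree f < card S"
    and roots: "\<And>x. x \<in> S \<Longrightarrow> p dvd poly f x"
    and incongruent: "\<And>x y. x \<in> S \<Longrightarrow> y \<in> S \<Longrightarrow> p dvd x - y \<Longrightarrow> x = y"
  shows "[:p:] dvd f"
  using assms(2-)
proof (induction "degree f" arbitrary: f S rule: less_induct)
  case less
  then obtain x where x: "x \<in> S"
    by fastforce
  show ?case
  proof (cases "degree f = 0")
    case True
    then obtain c where "f = [:c:]"
      by (metis degree_eq_zeroE)
    then show ?thesis
      using less.prems(3)[OF x] by simp
  next
    case False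
    define g where "g = synthetic_div f x"
    have f: "f = [:-x, 1:] * g + [:poly f x:]"
      using synthetic_div_correct'[of x f] by (simp add: g_def)
    have deg: "degree g = degree f - 1"
      by (simp add: g_def degree_synthetic_div)
    have "p dvd poly g y" if "y \<in> S - {x}" for y
    proof -
      have "poly f y = (y - x) * poly g y + poly f x"
        by (subst f) (simp add: algebra_simps)
      then have "p dvd (y - x) * poly g y"
        using less.prems(3) that x by (metis Diff_iff dvd_add_left_iff)
      then show ?thesis
        using less.prems(4)[of y x] that x \<open>prime p\<close> prime_dvd_mult_iff by auto
    qed
    then have "[:p:] dvd g"
      using False x less.prems deg by (intro less.hyps[of g "S - {x}"]) auto
    moreover have "[:p:] dvd [:poly f x:]"
      using less.prems(3)[OF x] by simp
    ultimately show ?thesis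
      by (subst f) (intro dvd_add dvd_mult)
  qed
qed

lemma P_prime_cong:
  assumes "prime p" and "odd p"
  shows "[:int p:] dvd P p - (1 - monom 1 (p - 1))"
proof (rule const_prime_dvd_poly_if_many_roots[where S = "int ` {..<p}"])
  have p1: "p > 1"
    using assms prime_gt_1_nat by blast
  \<comment> \<open>The factor for \<open>k = 0\<close> is constant, which keeps the degree below \<open>p\<close>.\<close>
  have "P p = (\<Prod>k=1..<p. [:1, int k:])"
    using p1 by (simp add: P_def lessThan_atLeast0 prod.atLeast_Suc_lessThan one_pCons)
  also have "degree \<dots> \<le> (\<Sum>k=1..<p. 1)"
    by (intro order.trans[OF degree_prod_sum_le] sum_mono) auto
  finally have "degree (P p) \<le> p - 1"
    by simp
  then have "degree (P p - (1 - monom 1 (p - 1))) \<le> p - 1"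
    by (intro degree_diff_le) (auto simp: degree_monom_eq)
  then show "degree (P p - (1 - monom 1 (p - 1))) < card (int ` {..<p})"
    using p1 by (simp add: card_image)
next
  fix x assume "x \<in> int ` {..<p}"
  then obtain n where n: "n < p" "x = int n"
    by auto
  have eval: "poly (P p) x = (\<Prod>k<p. 1 + x * int k)"
    by (simp add: P_def poly_prod)
  show "int p dvd poly (P p - (1 - monom 1 (p - 1))) x"
  proof (cases "n = 0")
    case True
    then show ?thesis
      using n prime_gt_1_nat[OF assms(1)] by (simp add: P_def poly_prod poly_monom power_0_left)
  next
    case False
    then have ndvd: "\<not> p dvd n"
      using n nat_dvd_not_less by blast
    then have "[n ^ (p - 1) = 1] (mod p)"
      using assms(1) fermat_theorem by blast
    then have "int p dvd 1 - x ^ (p - 1)"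
      using n by (metis cong_iff_dvd_diff cong_int_iff cong_sym of_nat_1 of_nat_power)
    moreover have "int p dvd poly (P p) x"
    proof -
      have "coprime x (int p)"
        using prime_imp_coprime[OF assms(1) ndvd] n by (simp add: coprime_commute)
      then obtain y where y: "[x * y = 1] (mod int p)"
        using cong_solve_coprime_int by blast
      \<comment> \<open>The index of the vanishing factor is the residue of \<open>- 1 / x\<close>.\<close>
      define k where "k = nat ((- y) mod int p)"
      have k: "int k = (- y) mod int p" "k < p"
        using prime_gt_0_nat[OF assms(1)] by (simp_all add: k_def nat_less_iff)
      have "[1 + x * int k = 1 + x * (- y)] (mod int p)"
        by (intro cong_add cong_mult cong_refl) (simp add: k(1))
      moreover have "int p dvd 1 + x * (- y)"
        using cong_sym[OF y] by (simp add: cong_iff_dvd_diff)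
      ultimately have "int p dvd 1 + x * int k"
        using cong_dvd_iff by blast
      with k(2) show ?thesis
        unfolding eval by (meson dvd_prodI dvd_trans finite_lessThan lessThan_iff)
    qed
    ultimately have "int p dvd poly (P p) x - (1 - x ^ (p - 1))"
      by (simp only: dvd_diff)
    then show ?thesis
      by (simp add: poly_monom)
  qed
next
  fix x y assume "x \<in> int ` {..<p}" "y \<in> int ` {..<p}" "int p dvd x - y"
  then show "x = y"
    by (auto simp: mod_eq_dvd_iff[symmetric])
qed (use assms in auto)

section \<open>Prime powers\<close>

theorem theorem2p1:
  fixes p r :: nat
  assumes "prime p" and "odd p" and "r > 0"
  shows "poly_cong (P (p ^ r)) ((1 - monom 1 (p - 1)) ^ (p ^ (r - 1))) (int p ^ r)"
proof -
  let ?F = "1 - monom 1 (p - 1) :: int poly"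
  have "[:int p ^ Suc s:] dvd P (p ^ Suc s) - ?F ^ (p ^ s)" for s
  proof (induction s)
    case 0
    show ?case
      using P_prime_cong[OF assms(1,2)] by simp
  next
    case (Suc s)
    define q where "q = p ^ Suc s"
    have "[:int q:] dvd P q - ?F ^ (p ^ s)"
      using Suc by (simp add: q_def)
    moreover have "of_nat p dvd [:int q:]"
      by (simp add: q_def of_nat_poly)
    ultimately have "of_nat p * [:int q:] dvd P q ^ p - (?F ^ (p ^ s)) ^ p"
      by (rule dvd_diff_power_lift)
    then have "[:int (p * q):] dvd P q ^ p - ?F ^ (p ^ Suc s)"
      by (simp add: of_nat_poly mult.commute flip: power_mult)
    moreover have "[:int (p * q):] dvd P (p * q) - P q ^ p"
      using assms(2) by (intro P_mult_cong_power) (simp_all add: q_def)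
    ultimately have "[:int (p * q):] dvd P (p * q) - ?F ^ (p ^ Suc s)"
      by (metis (no_types, lifting) diff_add_cancel add_diff_eq dvd_add)
    then show ?case
      by (simp add: q_def)
  qed
  from this[of "r - 1"] show ?thesis
    using assms(3) by (simp add: poly_cong_def const_poly_dvd_iff)
qed

end
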